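(* Let $\mathcal H$ be a real Hilbert space and let $f:\mathcal H\to\mathbb R$ be a $\mathcal C^1$ convex function whose gradient is $L$-Lipschitz continuous, with $S=\operatorname{argmin}_{\mathcal H} f\neq\emptyset$. Let $(y_k)$ be a sequence generated by (RAG$_\alpha$) with step size $s>0$, where $\alpha\ge 3$ and $sL\le 1$. Then: (i) $f(y_k)-\min_{\mathcal H} f=\mathcal O\left(\frac1{k^2}\right)$ as $k\to+\infty$. If, in addition, $\alpha>3$, then: (ii) $f(y_k)-\min_{\mathcal H} f=o\left(\frac1{k^2}\right)$ as $k\to+\infty$; (iii) let $(x_k)$ be the associated sequence given by $x_{k+1}=y_k-s\nabla f(y_k)$; then $(y_k)$ and $(x_k)$ converge weakly in $\mathcal H$ to the same limit, and this limit belongs to $S$.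
   Context: The Ravine accelerated gradient algorithm (RAG$_\alpha$) with step size $s>0$ is the recursion, started from two arbitrary points $y_0,y_1\in\mathcal H$ and run for $k\ge 1$, $$w_k=y_k-s\nabla f(y_k),\qquad y_{k+1}=w_k+\left(1-\tfrac{\alpha}{k+1}\right)(w_k-w_{k-1}),$$ with $w_0=y_0-s\nabla f(y_0)$. *)

theory Defs
  imports "HOL-Analysis.Analysis" "HOL-Library.Landau_Symbols"
begin

text \<open>A real Hilbert space is a type of class \<open>{real_inner, complete_space}\<close>.\<close>

definition argmin_set :: "('a \<Rightarrow> real) \<Rightarrow> 'a set" where
  "argmin_set f = {x. is_arg_min f (\<lambda>_. True) x}"

text \<open>Meaningful only when \<^term>\<open>argmin_set f\<close> is nonempty.\<close>

definition min_value :: "('a \<Rightarrow> real) \<Rightarrow> real" where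
  "min_value f = f (arg_min f (\<lambda>_. True))"

text \<open>Convergence in the weak topology, i.e. tested against the whole topological dual.\<close>

definition weakly_converges :: "(nat \<Rightarrow> 'a::real_normed_vector) \<Rightarrow> 'a \<Rightarrow> bool" where
  "weakly_converges u l \<longleftrightarrow>
     (\<forall>\<phi> :: 'a \<Rightarrow> real. bounded_linear \<phi> \<longrightarrow> (\<lambda>k. \<phi> (u k)) \<longlonglongrightarrow> \<phi> l)"

text \<open>
  \<open>g\<close> plays the role of the gradient of \<open>f\<close>. The starting points \<open>y 0\<close> and \<open>y 1\<close> are unconstrained.
\<close>

definition RAG ::
  "('a::real_inner \<Rightarrow> 'a) \<Rightarrow> real \<Rightarrow> real \<Rightarrow> (nat \<Rightarrow> 'a) \<Rightarrow> (nat \<Rightarrow> 'a) \<Rightarrow> bool" where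
  "RAG g \<alpha> s y w \<longleftrightarrow>
     w 0 = y 0 - s *\<^sub>R g (y 0) \<and>
     (\<forall>k\<ge>1. w k = y k - s *\<^sub>R g (y k) \<and>
            y (k + 1) = w k + (1 - \<alpha> / (real k + 1)) *\<^sub>R (w k - w (k - 1)))"

end

theory Submission
  imports Defs
begin

text \<open>
  Write \<open>m\<close> for the minimal value and \<open>T\<^sub>k = k / (\<alpha> - 1)\<close>. The Ravine points \<open>y\<^sub>k\<close> are the points where
  the gradient is evaluated; the points \<open>w\<^sub>k = y\<^sub>k - s g (y\<^sub>k)\<close> are the iterates of Nesterov's method, and
  for these there is the Lyapunov function
  \<open>E\<^sub>k(z) = T\<^sub>k\<^sup>2 (f w\<^sub>k - m) + |v\<^sub>k - z|\<^sup>2 / (2 s)\<close> with \<open>v\<^sub>k = w\<^sub>k + (T\<^sub>k - 1) (w\<^sub>k - w\<^sub>k\<^sub>-\<^sub>1)\<close>,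
  for every minimizer \<open>z\<close> (\<open>weight\<close>, \<open>energy\<close> and \<open>lead\<close> below). It decreases because \<open>v\<close> moves by \<open>- s T\<^sub>k g (y\<^sub>k)\<close> in step \<open>k\<close>, while the
  decrease of \<open>f\<close> is controlled by comparing \<open>w\<^sub>k\<close> with \<open>w\<^sub>k\<^sub>-\<^sub>1\<close> and with \<open>z\<close>; the two comparisons are
  combined with weights \<open>T\<^sub>k - 1\<close> and \<open>1\<close> (lemma \<open>energy_decrease\<close>). This gives \<open>f w\<^sub>k - m = O(1/k\<^sup>2)\<close>.

  The passage from \<open>w\<^sub>k\<close> to \<open>y\<^sub>k\<close> costs \<open>f y\<^sub>k \<le> f w\<^sub>k + s |g (y\<^sub>k)|\<^sup>2\<close>, so \<open>k\<^sup>2 |g (y\<^sub>k)|\<^sup>2\<close> has to be bounded.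
  In the limiting case \<open>s L = 1\<close> the usual descent inequality does not provide this. The sharper one (\<open>gradient_step\<close>), which keeps the
  cocoercivity term \<open>|g x - g y|\<^sup>2\<close>, adds \<open>k\<^sup>2 |g (w\<^sub>k\<^sub>-\<^sub>1) - g (y\<^sub>k)|\<^sup>2\<close> to the dissipation of \<open>E\<close>; this series
  converges, and \<open>|g (w\<^sub>k)|\<^sup>2\<close> is at most a multiple of \<open>f w\<^sub>k - m\<close>.

  For \<open>\<alpha> > 3\<close> the dissipation of \<open>E\<close> also contains a multiple of \<open>k (f w\<^sub>k - m)\<close>. With this summability, the
  mechanical energy \<open>f w\<^sub>k - m + |w\<^sub>k - w\<^sub>k\<^sub>-\<^sub>1|\<^sup>2 / (2 s)\<close> multiplied by \<open>k\<^sup>2\<close> converges and its quotient by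
  \<open>k\<close> is summable, so the limit is \<open>0\<close> (\<open>mechanical_energy_tendsto_zero\<close>). This is the little-o rate. It
  also says that \<open>k |w\<^sub>k - w\<^sub>k\<^sub>-\<^sub>1| \<longlonglongrightarrow> 0\<close>, so that in \<open>E\<^sub>k(z)\<close> everything but \<open>|w\<^sub>k - z|\<^sup>2 / (2 s)\<close> fades away:
  the distance to each minimizer converges.

  Weak convergence is then Opial's lemma. It is proved here by replacing weak cluster points with the points
  common to the closed convex hulls of all tails (\<open>tail_core\<close>). For a bounded sequence they exist by completeness
  (\<open>nested_closed_convex\<close>), and half-spaces and sublevel sets of \<open>f\<close> that contain a tail contain
  them, which is all that the argument asks of a weak cluster point.
\<close>

section \<open>Smooth convex functions\<close>

lemma norm_diff_scaleR_square:
  fixes a b :: "'a::real_inner"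
  shows "(norm (a - c *\<^sub>R b))\<^sup>2 = (norm a)\<^sup>2 - 2 * c * inner b a + c\<^sup>2 * (norm b)\<^sup>2"
  by (simp add: power2_norm_eq_inner inner_simps inner_commute power2_eq_square[of c] algebra_simps)

text \<open>
  The Lipschitz constant of the gradient is tied to the step size: any \<open>L\<close> with \<open>s L \<le> 1\<close> satisfies
  \<open>L \<le> 1 / s\<close>, and it enters the estimates only through this bound.
\<close>

locale smooth_convex =
  fixes f :: "'a::real_inner \<Rightarrow> real" and g :: "'a \<Rightarrow> 'a" and s :: real
  assumes gradient: "GDERIV f x :> g x"
    and lipschitz: "(1 / s)-lipschitz_on UNIV g"
    and convex: "convex_on UNIV f"
    and step_pos: "s > 0"
begin

lemma DERIV_along_line:
  "((\<lambda>t. f (a + t *\<^sub>R d)) has_real_derivative inner (g (a + t *\<^sub>R d)) d) (at t)"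
proof -
  have "((\<lambda>t. a + t *\<^sub>R d) has_derivative (\<lambda>h. h *\<^sub>R d)) (at t)"
    by (auto intro!: derivative_eq_intros)
  moreover have "(f has_derivative (\<lambda>h. inner h (g (a + t *\<^sub>R d)))) (at (a + t *\<^sub>R d))"
    using gradient by (simp add: gderiv_def)
  ultimately have "((\<lambda>t. f (a + t *\<^sub>R d)) has_derivative
      (\<lambda>h. inner (h *\<^sub>R d) (g (a + t *\<^sub>R d)))) (at t)"
    by (rule has_derivative_compose)
  then show ?thesis
    by (simp add: has_field_derivative_def inner_commute mult.commute[of _ "inner _ _"])
qed

lemma continuous: "continuous_on UNIV f"
  using gradient unfolding gderiv_def
  by (meson has_derivative_continuous continuous_at_imp_continuous_on)

text \<open>
  Along the segment from \<open>y\<close> to \<open>x\<close>, \<open>f\<close> minus the chord never exceeds its initial value, so its derivative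
  there is not positive.
\<close>

lemma above_tangent: "f x \<ge> f y + inner (g y) (x - y)"
proof (rule ccontr)
  assume "\<not> ?thesis"
  then have pos: "0 < inner (g y) (x - y) - (f x - f y)" by simp
  have "((\<lambda>t. f (y + t *\<^sub>R (x - y)) - t * (f x - f y)) has_real_derivative
      inner (g y) (x - y) - (f x - f y)) (at 0)"
    using DERIV_along_line[of y "x - y" 0] by (auto intro!: derivative_eq_intros)
  from DERIV_pos_inc_right[OF this pos] obtain d where d: "d > 0"
    "\<And>h. h > 0 \<Longrightarrow> h < d \<Longrightarrow> f y < f (y + h *\<^sub>R (x - y)) - h * (f x - f y)" by auto
  \<comment> \<open>A point where the derivative test applies and that still lies on the segment.\<close>
  define h where "h = min (d / 2) 1"
  have h: "h > 0" "h < d" "h \<le> 1" using d(1) by (auto simp: h_def)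
  have "f (y + h *\<^sub>R (x - y)) = f ((1 - h) *\<^sub>R y + h *\<^sub>R x)" by (simp add: algebra_simps)
  also have "\<dots> \<le> (1 - h) * f y + h * f x"
    using convex h by (intro convex_onD[where A = UNIV]) auto
  finally have "f (y + h *\<^sub>R (x - y)) - h * (f x - f y) \<le> f y" by (simp add: algebra_simps)
  with d(2)[OF h(1,2)] show False by simp
qed

text \<open>
  Subtracting the tangent and the quadratic \<open>t\<^sup>2 |d|\<^sup>2 / (2 s)\<close> from \<open>f\<close> along a segment leaves a function
  whose derivative is nonpositive, by the Lipschitz bound and the Cauchy-Schwarz inequality.
\<close>

lemma descent: "f b \<le> f a + inner (g a) (b - a) + (norm (b - a))\<^sup>2 / (2 * s)"
proof -
  define d where "d = b - a"
  define h where "h t = f (a + t *\<^sub>R d) - t * inner (g a) d - t\<^sup>2 * (norm d)\<^sup>2 / (2 * s)" for t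
  have "h 1 \<le> h 0"
  proof (rule DERIV_nonpos_imp_nonincreasing[of 0 1 h])
    fix t :: real assume t: "0 \<le> t" "t \<le> 1"
    have "(h has_real_derivative
        inner (g (a + t *\<^sub>R d)) d - inner (g a) d - t * (norm d)\<^sup>2 / s) (at t)"
      unfolding h_def using step_pos
      by (auto intro!: derivative_eq_intros DERIV_along_line simp: field_simps)
    moreover have "inner (g (a + t *\<^sub>R d)) d - inner (g a) d \<le> t * (norm d)\<^sup>2 / s"
    proof -
      have "inner (g (a + t *\<^sub>R d) - g a) d \<le> norm (g (a + t *\<^sub>R d) - g a) * norm d"
        by (rule norm_cauchy_schwarz)
      also have "norm (g (a + t *\<^sub>R d) - g a) \<le> (1 / s) * norm (t *\<^sub>R d)"
        using lipschitz_on_normD[OF lipschitz, of "a + t *\<^sub>R d" a] by simp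
      finally show ?thesis
        using t by (simp add: inner_diff_left power2_eq_square mult_right_mono mult_ac)
    qed
    ultimately show "\<exists>y. (h has_real_derivative y) (at t) \<and> y \<le> 0" by auto
  qed simp
  then show ?thesis by (simp add: h_def d_def)
qed

text \<open>
  Cocoercivity of the gradient. The point \<open>z\<close> in the proof is a gradient step from \<open>x\<close> for the convex function
  \<open>\<lambda>u. f u - inner (g y) u\<close>, whose minimum is attained at \<open>y\<close>; the decrease along this
  step is the extra quadratic term.
\<close>

lemma above_tangent_strong:
  "f x \<ge> f y + inner (g y) (x - y) + s / 2 * (norm (g x - g y))\<^sup>2"
proof -
  define e where "e = g x - g y"
  define z where "z = x - s *\<^sub>R e"
  have "f y + inner (g y) (z - y) \<le> f z" by (rule above_tangent)
  also have "\<dots> \<le> f x + inner (g x) (z - x) + (norm (z - x))\<^sup>2 / (2 * s)" by (rule descent)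
  finally have "f y + inner (g y) (x - y) + s * inner (g x - g y) e \<le> f x + s / 2 * (norm e)\<^sup>2"
    using step_pos by (simp add: z_def inner_simps power2_eq_square field_simps)
  then show ?thesis by (simp add: e_def[symmetric] power2_norm_eq_inner)
qed

text \<open>
  One gradient step from \<open>y\<close>, compared with an arbitrary point \<open>x\<close>. The term
  \<open>s / 2 * |g x - g y|\<^sup>2\<close> goes beyond the usual descent inequality and is what makes the values at the
  points \<open>y\<^sub>k\<close>, and not merely at the points \<open>w\<^sub>k\<close>, decay fast.
\<close>

lemma gradient_step:
  "f (y - s *\<^sub>R g y) + s / 2 * (norm (g y))\<^sup>2 + s / 2 * (norm (g x - g y))\<^sup>2
     \<le> f x + inner (g y) (y - x)"
proof -
  have "f (y - s *\<^sub>R g y) \<le> f y - s * (norm (g y))\<^sup>2 + s / 2 * (norm (g y))\<^sup>2"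
    using descent[of "y - s *\<^sub>R g y" y] step_pos
    by (simp add: dot_square_norm power_mult_distrib power2_eq_square[of s] field_simps)
  with above_tangent_strong[of y x] show ?thesis by (simp add: inner_diff_right)
qed

end

section \<open>Opial's lemma\<close>

text \<open>
  Almost minimal vectors of the sets \<open>C n\<close> form a Cauchy sequence: the midpoint of two of them lies in the
  larger of their sets, so by the parallelogram law they are close once the squared minimal norms \<open>\<delta> n\<close>,
  which increase and are bounded, have nearly settled.
\<close>

lemma nested_closed_convex:
  fixes C :: "nat \<Rightarrow> 'a::{real_inner, complete_space} set"
  assumes closed: "\<And>n. closed (C n)" and convex: "\<And>n. convex (C n)"
    and nonempty: "\<And>n. C n \<noteq> {}" and bounded: "bounded (C 0)" and decreasing: "decseq C"
  shows "(\<Inter>n. C n) \<noteq> {}"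
proof -
  define \<delta> where "\<delta> n = (INF x\<in>C n. (norm x)\<^sup>2)" for n
  have bdd: "bdd_below ((\<lambda>x. (norm x)\<^sup>2) ` C n)" for n
    by (rule bdd_belowI2[where m = 0]) simp
  have \<delta>_le: "\<delta> n \<le> (norm x)\<^sup>2" if "x \<in> C n" for n x
    unfolding \<delta>_def using bdd that by (rule cINF_lower)
  have sub: "C m \<subseteq> C n" if "n \<le> m" for m n using decreasing that by (auto simp: decseq_def)
  have \<delta>_mono: "\<delta> n \<le> \<delta> m" if "n \<le> m" for m n
    unfolding \<delta>_def[of m] using nonempty sub[OF that] \<delta>_le by (intro cINF_greatest) auto
  obtain B where B: "\<And>x. x \<in> C 0 \<Longrightarrow> norm x \<le> B" using bounded by (auto simp: bounded_iff)
  have "\<delta> n \<le> B\<^sup>2" for n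
  proof -
    obtain x where x: "x \<in> C n" using nonempty by blast
    then have "norm x \<le> B" using sub[of 0 n] B by auto
    then show ?thesis using \<delta>_le[OF x] power_mono[of "norm x" B 2] by simp
  qed
  then have "\<exists>D. \<delta> \<longlonglongrightarrow> D"
    using incseq_convergent[of \<delta> "B\<^sup>2"] \<delta>_mono by (metis incseq_def)
  then have \<delta>_Cauchy: "Cauchy \<delta>" using LIMSEQ_imp_Cauchy by blast
  define r where "r n = 1 / real (Suc n)" for n
  have "\<exists>x\<in>C n. (norm x)\<^sup>2 < \<delta> n + r n" for n
    using cINF_less_iff[OF nonempty bdd, of n "\<delta> n + r n"] unfolding \<delta>_def[symmetric]
    by (simp add: r_def)
  then obtain p where p: "\<And>n. p n \<in> C n" "\<And>n. (norm (p n))\<^sup>2 < \<delta> n + r n" by metis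
  have dist: "(norm (p m - p n))\<^sup>2 \<le> 2 * (\<delta> m - \<delta> n) + 4 * r n" if "n \<le> m" for m n
  proof -
    have "(1 / 2) *\<^sub>R p m + (1 / 2) *\<^sub>R p n \<in> C n"
      using sub[OF that] p(1) by (intro convexD[OF convex]) auto
    then have "\<delta> n \<le> (norm ((1 / 2) *\<^sub>R (p m + p n)))\<^sup>2" using \<delta>_le by (simp add: scaleR_add_right)
    then have "4 * \<delta> n \<le> (norm (p m + p n))\<^sup>2" by (simp add: power_divide)
    moreover have "(norm (p m - p n))\<^sup>2 = 2 * (norm (p m))\<^sup>2 + 2 * (norm (p n))\<^sup>2 - (norm (p m + p n))\<^sup>2"
      by (simp add: power2_norm_eq_inner inner_simps inner_commute)
    moreover have "r m \<le> r n" using that by (simp add: r_def field_simps)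
    ultimately show ?thesis using p(2)[of m] p(2)[of n] by (simp add: algebra_simps)
  qed
  have "Cauchy p"
  proof (rule CauchyI)
    fix e :: real assume e: "e > 0"
    obtain M where M: "\<And>m n. m \<ge> M \<Longrightarrow> n \<ge> M \<Longrightarrow> \<bar>\<delta> m - \<delta> n\<bar> < e\<^sup>2 / 4"
      using CauchyD[OF \<delta>_Cauchy, of "e\<^sup>2 / 4"] e by (auto simp: real_norm_def)
    obtain K :: nat where K: "r K < e\<^sup>2 / 8"
      using nat_approx_posE[of "e\<^sup>2 / 8"] e by (auto simp: r_def)
    have close: "norm (p m - p n) < e" if "n \<le> m" "max M K \<le> n" for m n
    proof -
      have "r n \<le> r K" using that by (simp add: r_def field_simps)
      then have "(norm (p m - p n))\<^sup>2 < e\<^sup>2"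
        using dist[OF that(1)] M[of m n] that K abs_ge_self[of "\<delta> m - \<delta> n"] by simp
      then show ?thesis using e by (simp add: power_less_imp_less_base)
    qed
    show "\<exists>M. \<forall>m\<ge>M. \<forall>n\<ge>M. norm (p m - p n) < e"
    proof (intro exI allI impI)
      fix m n assume "max M K \<le> m" "max M K \<le> n"
      then show "norm (p m - p n) < e"
        using close[of n m] close[of m n] by (cases "n \<le> m") (auto simp: norm_minus_commute)
    qed
  qed
  then obtain q where q: "p \<longlonglongrightarrow> q" using Cauchy_convergent convergent_def by blast
  have "q \<in> C n" for n
  proof (rule Lim_in_closed_set[OF closed _ _ q])
    show "\<forall>\<^sub>F k in sequentially. p k \<in> C n"
      using eventually_ge_at_top[of n] by eventually_elim (use p(1) sub in blast)
  qed simp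
  then show ?thesis by blast
qed

text \<open>
  A substitute for the set of weak cluster points. The index set \<open>A\<close> selects a subsequence, given as a set
  so that passing to a subsequence is monotonicity in \<open>A\<close>.
\<close>

definition tail_core :: "(nat \<Rightarrow> 'a::real_normed_vector) \<Rightarrow> nat set \<Rightarrow> 'a set" where
  "tail_core u A = (\<Inter>N. closure (convex hull (u ` (A \<inter> {N..}))))"

lemma tail_core_nonempty:
  fixes u :: "nat \<Rightarrow> 'a::{real_inner, complete_space}"
  assumes "bounded (range u)" and "infinite A"
  shows "tail_core u A \<noteq> {}"
  unfolding tail_core_def
proof (rule nested_closed_convex)
  show "convex (closure (convex hull (u ` (A \<inter> {n..}))))" for n
    by (intro convex_closure convex_convex_hull)
  show "closure (convex hull (u ` (A \<inter> {n..}))) \<noteq> {}" for n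
    using assms(2) by (auto simp: infinite_nat_iff_unbounded_le)
  show "bounded (closure (convex hull (u ` (A \<inter> {0..}))))"
    using assms(1) by (intro bounded_closure bounded_convex_hull) (auto intro: bounded_subset)
  show "decseq (\<lambda>n. closure (convex hull (u ` (A \<inter> {n..}))))"
    unfolding decseq_def by (intro allI impI closure_mono hull_mono) auto
qed simp

lemma tail_core_mono: "A \<subseteq> B \<Longrightarrow> tail_core u A \<subseteq> tail_core u B"
  unfolding tail_core_def by (intro INF_superset_mono closure_mono hull_mono) auto

lemma tail_core_subset_closed_convex:
  assumes "closed C" "convex C" and "\<And>k. k \<in> A \<Longrightarrow> N \<le> k \<Longrightarrow> u k \<in> C"
  shows "tail_core u A \<subseteq> C"
proof -
  have "closure (convex hull (u ` (A \<inter> {N..}))) \<subseteq> C"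
    using assms by (intro closure_minimal hull_minimal) auto
  then show ?thesis by (auto simp: tail_core_def)
qed

lemma convex_halfspace_functional:
  fixes \<phi> :: "'a::real_normed_vector \<Rightarrow> real"
  assumes "bounded_linear \<phi>"
  shows "closed {x. \<phi> x \<le> c}" "convex {x. \<phi> x \<le> c}"
proof -
  show "closed {x. \<phi> x \<le> c}"
    by (intro closed_Collect_le linear_continuous_on[OF assms] continuous_intros)
  have "linear \<phi>" using assms by (rule bounded_linear.linear)
  then have "convex (\<phi> -` {..c})" by (rule convex_linear_vimage) simp
  then show "convex {x. \<phi> x \<le> c}" by (simp add: vimage_def)
qed

lemma tail_core_functional_tendsto:
  fixes \<phi> :: "'a::real_normed_vector \<Rightarrow> real"
  assumes \<phi>: "bounded_linear \<phi>" and lim: "(\<lambda>k. \<phi> (u k)) \<longlonglongrightarrow> c" and p: "p \<in> tail_core u UNIV"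
  shows "\<phi> p = c"
proof -
  have upper: "\<psi> p \<le> d" if \<psi>: "bounded_linear \<psi>" and l: "(\<lambda>k. \<psi> (u k)) \<longlonglongrightarrow> d" for \<psi> :: "'a \<Rightarrow> real" and d
  proof (rule field_le_epsilon)
    fix e :: real assume "e > 0"
    with l have "\<forall>\<^sub>F k in sequentially. \<psi> (u k) < d + e" by (intro order_tendstoD) auto
    then obtain N where "\<And>k. N \<le> k \<Longrightarrow> \<psi> (u k) < d + e" by (auto simp: eventually_sequentially)
    then have "tail_core u UNIV \<subseteq> {x. \<psi> x \<le> d + e}"
      by (intro tail_core_subset_closed_convex convex_halfspace_functional \<psi>) (auto intro: less_imp_le)
    with p show "\<psi> p \<le> d + e" by auto
  qed
  from upper[OF \<phi> lim] upper[OF bounded_linear_minus[OF \<phi>] tendsto_minus[OF lim]]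
  show ?thesis by simp
qed

text \<open>
  Polarization turns convergence of the distances to two points \<open>p, q\<close> of \<open>S\<close> into convergence of the inner
  products of \<open>u k\<close> with \<open>p - q\<close>. If both points belong to the core, each of them inherits this limit as its own
  inner product with \<open>p - q\<close>, so \<open>p = q\<close>. The core is thus a single point \<open>l\<close>, also for every
  subsequence. If a functional \<open>\<phi>\<close> stayed above \<open>c > \<phi> l\<close> along a subsequence, the core of that
  subsequence would lie in the half-space \<open>\<phi> \<ge> c\<close> and yet consist of \<open>l\<close>.
\<close>

lemma opial:
  fixes u :: "nat \<Rightarrow> 'a::{real_inner, complete_space}"
  assumes nonempty: "S \<noteq> {}"
    and dist: "\<And>z. z \<in> S \<Longrightarrow> convergent (\<lambda>k. norm (u k - z))"
    and core: "tail_core u UNIV \<subseteq> S"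
  shows "\<exists>l\<in>S. weakly_converges u l"
proof -
  obtain z0 where z0: "z0 \<in> S" using nonempty by blast
  obtain B where B: "\<And>k. norm (u k - z0) \<le> B"
    using convergent_imp_Bseq[OF dist[OF z0]] by (auto simp: Bseq_def)
  have bounded: "bounded (range u)"
    unfolding bounded_iff
  proof (intro exI ballI)
    fix x assume "x \<in> range u"
    then show "norm x \<le> B + norm z0"
      using B norm_triangle_sub[of x z0] by (auto intro: order_trans)
  qed
  have unique: "p = q" if p: "p \<in> tail_core u UNIV" and q: "q \<in> tail_core u UNIV" for p q
  proof -
    obtain a b where ab: "(\<lambda>k. norm (u k - p)) \<longlonglongrightarrow> a" "(\<lambda>k. norm (u k - q)) \<longlonglongrightarrow> b"
      using dist core p q unfolding convergent_def by blast
    have lin: "bounded_linear (\<lambda>x. inner x (p - q))" by (rule bounded_linear_inner_left)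
    have "inner (u k) (p - q)
        = ((norm (u k - q))\<^sup>2 - (norm (u k - p))\<^sup>2 + (norm p)\<^sup>2 - (norm q)\<^sup>2) / 2" for k
      by (simp add: power2_norm_eq_inner inner_simps inner_commute)
    moreover have "(\<lambda>k. ((norm (u k - q))\<^sup>2 - (norm (u k - p))\<^sup>2 + (norm p)\<^sup>2 - (norm q)\<^sup>2) / 2)
        \<longlonglongrightarrow> (b\<^sup>2 - a\<^sup>2 + (norm p)\<^sup>2 - (norm q)\<^sup>2) / 2"
      by (intro tendsto_intros ab) auto
    ultimately have "(\<lambda>k. inner (u k) (p - q)) \<longlonglongrightarrow> (b\<^sup>2 - a\<^sup>2 + (norm p)\<^sup>2 - (norm q)\<^sup>2) / 2"
      by (simp only:)
    from tail_core_functional_tendsto[OF lin this p] tail_core_functional_tendsto[OF lin this q]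
    have "inner (p - q) (p - q) = 0" by (simp add: inner_diff_left)
    then show ?thesis by simp
  qed
  obtain l where l: "l \<in> tail_core u UNIV"
    using tail_core_nonempty[OF bounded infinite_UNIV_nat] by blast
  have upper: "\<forall>\<^sub>F k in sequentially. \<phi> (u k) < c"
    if \<phi>: "bounded_linear \<phi>" and c: "\<phi> l < c" for \<phi> :: "'a \<Rightarrow> real" and c
  proof (rule ccontr)
    define A where "A = {k. c \<le> \<phi> (u k)}"
    assume "\<not> (\<forall>\<^sub>F k in sequentially. \<phi> (u k) < c)"
    then have "infinite A"
      by (auto simp: A_def infinite_nat_iff_unbounded_le eventually_sequentially not_less)
    then obtain p where p: "p \<in> tail_core u A" using tail_core_nonempty[OF bounded] by blast
    then have "p = l" using tail_core_mono[of A UNIV u] l unique by auto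
    moreover have "tail_core u A \<subseteq> {x. - \<phi> x \<le> - c}"
      by (rule tail_core_subset_closed_convex[where N = 0])
         (auto simp only: convex_halfspace_functional[OF bounded_linear_minus[OF \<phi>]], simp add: A_def)
    ultimately show False using p c by auto
  qed
  have "weakly_converges u l"
    unfolding weakly_converges_def
  proof (intro allI impI order_tendstoI)
    fix \<phi> :: "'a \<Rightarrow> real" and c assume \<phi>: "bounded_linear \<phi>"
    show "\<forall>\<^sub>F k in sequentially. \<phi> (u k) < c" if "\<phi> l < c" using upper[OF \<phi> that] .
    show "\<forall>\<^sub>F k in sequentially. c < \<phi> (u k)" if "c < \<phi> l"
      using upper[OF bounded_linear_minus[OF \<phi>], of "- c"] that by simp
  qed
  then show ?thesis using l core by blast
qed

lemma weakly_converges_add_null: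
  assumes u: "weakly_converges u l" and d: "(\<lambda>k. u' k - u k) \<longlonglongrightarrow> 0"
  shows "weakly_converges u' l"
  unfolding weakly_converges_def
proof (intro allI impI)
  fix \<phi> :: "'a \<Rightarrow> real" assume \<phi>: "bounded_linear \<phi>"
  have "(\<lambda>k. \<phi> (u k) + \<phi> (u' k - u k)) \<longlonglongrightarrow> \<phi> l + \<phi> 0"
    using u \<phi> by (intro tendsto_add bounded_linear.tendsto[OF \<phi> d]) (auto simp: weakly_converges_def)
  then show "(\<lambda>k. \<phi> (u' k)) \<longlonglongrightarrow> \<phi> l"
    using \<phi> by (simp add: linear_simps)
qed

lemma weakly_converges_offset:
  "weakly_converges (\<lambda>k. u (Suc k)) l \<Longrightarrow> weakly_converges u l"
  unfolding weakly_converges_def by (simp only: filterlim_sequentially_Suc[of "\<lambda>k. _ (u k)"])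

section \<open>Almost decreasing sequences\<close>

text \<open>
  Subtracting the partial sums of \<open>b\<close> from \<open>a\<close> gives a decreasing sequence that is bounded below, and the total
  decrease dominates the series of \<open>c\<close>.
\<close>

lemma quasi_decreasing:
  fixes a b c :: "nat \<Rightarrow> real"
  assumes a: "\<And>k. N \<le> k \<Longrightarrow> 0 \<le> a k" and c: "\<And>k. N \<le> k \<Longrightarrow> 0 \<le> c k"
    and b: "summable b"
    and step: "\<And>k. N \<le> k \<Longrightarrow> a (Suc k) + c k \<le> a k + b k"
  shows "convergent a" "summable c"
proof -
  define a' b' c' where "a' k = a (k + N)" "b' k = b (k + N)" "c' k = c (k + N)" for k
  have b': "summable b'" unfolding a'_b'_c'_def using b by (simp add: summable_iff_shift)
  define r where "r k = a' k - (\<Sum>i<k. b' i)" for k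
  have r_step: "r (Suc k) + c' k \<le> r k" for k
    using step[of "k + N"] by (simp add: r_def a'_b'_c'_def)
  have c': "0 \<le> c' k" for k using c by (simp add: a'_b'_c'_def)
  have "Bseq (\<lambda>k. \<Sum>i<k. b' i)"
    using b' by (intro convergent_imp_Bseq) (simp add: summable_iff_convergent)
  then obtain K where K: "\<And>k. \<bar>\<Sum>i<k. b' i\<bar> \<le> K" by (auto simp: Bseq_def)
  have r_lower: "- K \<le> r k" for k
    using K[of k] a[of "k + N"] by (simp add: r_def a'_b'_c'_def)
  have "decseq r" using r_step c' by (intro decseq_SucI) (smt (verit))
  then have "convergent r" using decseq_convergent[of r "- K"] r_lower by (metis convergent_def)
  moreover have "convergent (\<lambda>k. \<Sum>i<k. b' i)" using b' by (simp add: summable_iff_convergent)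
  ultimately have "convergent (\<lambda>k. r k + (\<Sum>i<k. b' i))" by (rule convergent_add)
  then have "convergent a'" by (simp add: r_def)
  then show "convergent a" unfolding a'_b'_c'_def by (simp add: convergent_ignore_initial_segment)
  have "(\<Sum>i<k. c' i) \<le> r 0 - r k" for k
    by (induction k) (use r_step in \<open>auto simp: algebra_simps intro: order_trans\<close>, smt (verit) r_step)
  then have "(\<Sum>i<k. c' i) \<le> r 0 + K" for k using r_lower[of k] by (smt (verit))
  then have "summable c'" using c' by (intro summableI_nonneg_bounded)
  then show "summable c" unfolding a'_b'_c'_def by (simp add: summable_iff_shift)
qed

text \<open>
  A positive limit would make the harmonic series converge.
\<close>

lemma tendsto_zero_if_summable_over_index:
  fixes F :: "nat \<Rightarrow> real"
  assumes conv: "convergent F" and nonneg: "\<And>k. 0 \<le> F k" and sum: "summable (\<lambda>k. F k / real k)"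
  shows "F \<longlonglongrightarrow> 0"
proof -
  obtain l where l: "F \<longlonglongrightarrow> l" using conv by (auto simp: convergent_def)
  have "l \<ge> 0" using l nonneg by (intro LIMSEQ_le_const) auto
  moreover have False if "l > 0"
  proof -
    from l that have "\<forall>\<^sub>F k in sequentially. l / 2 < F k" by (intro order_tendstoD) auto
    then have "\<forall>\<^sub>F k in sequentially. norm (l / 2 * inverse (real k)) \<le> F k / real k"
      by eventually_elim (use that in \<open>auto simp: divide_simps\<close>)
    then have "summable (\<lambda>k. l / 2 * inverse (real k))" using sum by (rule summable_comparison_test_ev)
    then have "summable (\<lambda>k. inverse (real k))" using that by (subst (asm) summable_cmult_iff) auto
    then show False using not_summable_harmonic[where 'a = real] by (simp add: inverse_eq_divide)
  qed
  ultimately show ?thesis using l by (cases "l = 0") auto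
qed

section \<open>The Lyapunov function of the Ravine iteration\<close>

lemma min_value_eq: "z \<in> argmin_set f \<Longrightarrow> min_value f = f z"
  unfolding argmin_set_def min_value_def
  by (rule arg_min_equality) (auto simp: is_arg_min_linorder)

lemma argmin_set_iff:
  assumes "argmin_set f \<noteq> {}"
  shows "x \<in> argmin_set f \<longleftrightarrow> f x \<le> min_value f"
proof -
  obtain z where "z \<in> argmin_set f" using assms by blast
  with min_value_eq[OF this] show ?thesis
    by (auto simp: argmin_set_def is_arg_min_linorder intro: order_trans)
qed

lemma min_value_le: "argmin_set f \<noteq> {} \<Longrightarrow> min_value f \<le> f x"
  using min_value_eq by (fastforce simp: argmin_set_def is_arg_min_linorder)

locale ravine = smooth_convex f g s
  for f :: "'a::real_inner \<Rightarrow> real" and g s +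
  fixes \<alpha> :: real and y w :: "nat \<Rightarrow> 'a"
  assumes minimizers: "argmin_set f \<noteq> {}"
    and alpha: "\<alpha> \<ge> 3"
    and algorithm: "RAG g \<alpha> s y w"
begin

definition gap :: "nat \<Rightarrow> real" where "gap k = f (w k) - min_value f"

text \<open>The series of its squares, weighted by \<open>k\<^sup>2\<close>, will converge thanks to the extra term in \<open>gradient_step\<close>.\<close>

definition grad_jump :: "nat \<Rightarrow> 'a" where "grad_jump k = g (w k) - g (y (Suc k))"

text \<open>
  The coefficients \<open>t\<^sub>k\<close> of Nesterov's method, normalized so that \<open>(t\<^sub>k - 1) / t\<^sub>k\<^sub>+\<^sub>1\<close> is the
  extrapolation coefficient \<open>1 - \<alpha> / (k + 1)\<close>.
\<close>

definition weight :: "nat \<Rightarrow> real" where "weight k = real k / (\<alpha> - 1)"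

text \<open>
  The extrapolation of the last displacement by the weight. A step of the algorithm changes it by a multiple of the
  gradient alone (\<open>lead_Suc\<close>).
\<close>

definition lead :: "nat \<Rightarrow> 'a" where "lead k = w k + (weight k - 1) *\<^sub>R (w k - w (k - 1))"

definition energy :: "'a \<Rightarrow> nat \<Rightarrow> real" where
  "energy z k = (weight k)\<^sup>2 * gap k + (norm (lead k - z))\<^sup>2 / (2 * s)"

definition kinetic :: "nat \<Rightarrow> real" where
  "kinetic k = (norm (w k - w (k - 1)))\<^sup>2 / (2 * s)"

lemma gap_nonneg: "0 \<le> gap k"
  using min_value_le[OF minimizers] by (simp add: gap_def)

lemma kinetic_nonneg: "0 \<le> kinetic k"
  using step_pos by (simp add: kinetic_def)

lemma energy_nonneg: "0 \<le> energy z k"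
  using step_pos gap_nonneg by (simp add: energy_def)

lemma w_eq: "w k = y k - s *\<^sub>R g (y k)"
  using algorithm by (cases "k \<ge> 1") (auto simp: RAG_def not_le)

lemma y_Suc: "k \<ge> 1 \<Longrightarrow> y (Suc k) = w k + (1 - \<alpha> / real (Suc k)) *\<^sub>R (w k - w (k - 1))"
  using algorithm by (simp add: RAG_def add.commute)

lemma weight_Suc_minus_1: "weight (Suc k) * (1 - \<alpha> / real (Suc k)) = weight k - 1"
  using alpha unfolding weight_def by (simp add: divide_simps)

lemma lead_eq_before_step:
  assumes "k \<ge> 1"
  shows "weight (Suc k) *\<^sub>R y (Suc k) - (weight (Suc k) - 1) *\<^sub>R w k = lead k"
proof -
  have "weight (Suc k) *\<^sub>R y (Suc k) - (weight (Suc k) - 1) *\<^sub>R w k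
      = w k + (weight (Suc k) * (1 - \<alpha> / real (Suc k))) *\<^sub>R (w k - w (k - 1))"
    unfolding y_Suc[OF assms] scaleR_add_right scaleR_scaleR by (simp add: algebra_simps)
  then show ?thesis unfolding weight_Suc_minus_1 lead_def .
qed

lemma lead_Suc:
  assumes "k \<ge> 1"
  shows "lead (Suc k) = lead k - (s * weight (Suc k)) *\<^sub>R g (y (Suc k))"
proof -
  have "lead (Suc k) = weight (Suc k) *\<^sub>R w (Suc k) - (weight (Suc k) - 1) *\<^sub>R w k"
    by (simp add: lead_def algebra_simps)
  also have "\<dots> = weight (Suc k) *\<^sub>R y (Suc k) - (weight (Suc k) - 1) *\<^sub>R w k - (s * weight (Suc k)) *\<^sub>R g (y (Suc k))"
    unfolding w_eq[of "Suc k"] by (simp add: scaleR_diff_right mult.commute)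
  finally show ?thesis unfolding lead_eq_before_step[OF assms] .
qed

text \<open>
  Inequality \<open>A\<close> compares \<open>w (Suc k)\<close> with \<open>w k\<close>, inequality \<open>B\<close> compares it with the minimizer \<open>z\<close>. With the weights
  \<open>t (t - 1)\<close> and \<open>t\<close>, their inner products add up to the one of \<open>t G\<close> with \<open>lead k - z\<close>, which is also
  the cross term in the expansion of \<open>|lead (Suc k) - z|\<^sup>2\<close>, and the terms in \<open>|G|\<^sup>2\<close> cancel. The coefficient
  of \<open>gap k\<close> is \<open>t\<^sub>k\<^sup>2 - t\<^sub>k\<^sub>+\<^sub>1\<^sup>2 + t\<^sub>k\<^sub>+\<^sub>1\<close>; it is nonnegative for \<open>\<alpha> \<ge> 3\<close>
  and of order \<open>k\<close> for \<open>\<alpha> > 3\<close>.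
\<close>

lemma energy_decrease:
  assumes k: "k \<ge> 1" and weight_ge: "weight (Suc k) \<ge> 1" and z: "z \<in> argmin_set f"
  shows "energy z (Suc k) + (1 + real (Suc k) * (\<alpha> - 3)) / (\<alpha> - 1)\<^sup>2 * gap k
      + s / 2 * (weight (Suc k) * (weight (Suc k) - 1)) * (norm (grad_jump k))\<^sup>2 \<le> energy z k"
proof -
  define t Y G where "t = weight (Suc k)" and "Y = y (Suc k)" and "G = g (y (Suc k))"
  have w: "w (Suc k) = Y - s *\<^sub>R g Y" using w_eq by (simp add: Y_def)
  have A: "gap (Suc k) + s / 2 * (norm G)\<^sup>2 + s / 2 * (norm (grad_jump k))\<^sup>2 \<le> gap k + inner G (Y - w k)"
    using gradient_step[of Y "w k"] by (simp add: gap_def w grad_jump_def G_def Y_def)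
  have "0 \<le> s / 2 * (norm (g z - G))\<^sup>2" using step_pos by simp
  then have B: "gap (Suc k) + s / 2 * (norm G)\<^sup>2 \<le> inner G (Y - z)"
    using gradient_step[of Y z] by (simp add: gap_def w min_value_eq[OF z] G_def Y_def)
  have t: "0 \<le> t * (t - 1)" "0 \<le> t" using weight_ge by (auto simp: t_def)
  have comb: "inner (t *\<^sub>R G) (lead k - z) = t * (t - 1) * inner G (Y - w k) + t * inner G (Y - z)"
    unfolding lead_eq_before_step[OF k, symmetric] t_def Y_def
    by (simp add: inner_simps algebra_simps)
  have "t * (t - 1) * (gap (Suc k) + s / 2 * (norm G)\<^sup>2 + s / 2 * (norm (grad_jump k))\<^sup>2)
        + t * (gap (Suc k) + s / 2 * (norm G)\<^sup>2)
      \<le> t * (t - 1) * (gap k + inner G (Y - w k)) + t * inner G (Y - z)"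
    by (intro add_mono mult_left_mono A B t)
  then have main: "t\<^sup>2 * gap (Suc k) + s / 2 * (t * (t - 1)) * (norm (grad_jump k))\<^sup>2
      \<le> t * (t - 1) * gap k + inner (t *\<^sub>R G) (lead k - z) - s / 2 * t\<^sup>2 * (norm G)\<^sup>2"
    unfolding comb
    by (simp add: algebra_simps power2_eq_square[of t] add_divide_distrib diff_divide_distrib)
  have "lead (Suc k) - z = (lead k - z) - s *\<^sub>R (t *\<^sub>R G)"
    using lead_Suc[OF k] by (simp add: t_def G_def)
  then have "(norm (lead (Suc k) - z))\<^sup>2
      = (norm (lead k - z))\<^sup>2 - 2 * s * inner (t *\<^sub>R G) (lead k - z) + s\<^sup>2 * t\<^sup>2 * (norm G)\<^sup>2"
    by (simp only: norm_diff_scaleR_square norm_scaleR power_mult_distrib power2_abs mult.assoc)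
  then have "(norm (lead (Suc k) - z))\<^sup>2 / (2 * s)
      = (norm (lead k - z))\<^sup>2 / (2 * s) - inner (t *\<^sub>R G) (lead k - z) + s / 2 * t\<^sup>2 * (norm G)\<^sup>2"
    using step_pos by (simp add: field_simps power2_eq_square)
  with main have "energy z (Suc k) + s / 2 * (t * (t - 1)) * (norm (grad_jump k))\<^sup>2
      \<le> t * (t - 1) * gap k + (norm (lead k - z))\<^sup>2 / (2 * s)"
    by (simp add: energy_def t_def)
  moreover define c where "c = (1 + real (Suc k) * (\<alpha> - 3)) / (\<alpha> - 1)\<^sup>2"
  moreover have "t * (t - 1) = (weight k)\<^sup>2 - c"
    using alpha unfolding t_def weight_def c_def
    by (simp add: divide_simps power2_eq_square) (simp add: algebra_simps)
  ultimately show ?thesis unfolding t_def[symmetric] energy_def[of z k] c_def[symmetric]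
    by (simp only: left_diff_distrib)
qed

text \<open>
  From this index on the weights exceed \<open>1\<close> and \<open>energy_decrease\<close> applies; for smaller indices the
  extrapolation coefficient may be negative.
\<close>

definition onset :: nat where "onset = nat \<lceil>\<alpha>\<rceil>"

lemma onset_ge: "real onset \<ge> \<alpha>" "onset \<ge> 1"
  using alpha unfolding onset_def by linarith+

lemma weight_Suc_ge: "onset \<le> k \<Longrightarrow> weight (Suc k) \<ge> 1"
  using alpha onset_ge(1) by (simp add: weight_def field_simps)

lemma damping_nonneg: "0 \<le> (1 + real (Suc k) * (\<alpha> - 3)) / (\<alpha> - 1)\<^sup>2"
  using alpha by simp

lemma energy_consequences:
  assumes z: "z \<in> argmin_set f"
  shows "convergent (energy z)"
    and "summable (\<lambda>k. (1 + real (Suc k) * (\<alpha> - 3)) / (\<alpha> - 1)\<^sup>2 * gap k)"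
    and "summable (\<lambda>k. s / 2 * (weight (Suc k) * (weight (Suc k) - 1)) * (norm (grad_jump k))\<^sup>2)"
proof -
  define c1 where "c1 = (\<lambda>k. (1 + real (Suc k) * (\<alpha> - 3)) / (\<alpha> - 1)\<^sup>2 * gap k)"
  define c2 where "c2 = (\<lambda>k. s / 2 * (weight (Suc k) * (weight (Suc k) - 1)) * (norm (grad_jump k))\<^sup>2)"
  have c1: "0 \<le> c1 k" for k unfolding c1_def by (intro mult_nonneg_nonneg damping_nonneg gap_nonneg)
  have c2: "0 \<le> c2 k" if "onset \<le> k" for k
    using weight_Suc_ge[OF that] step_pos unfolding c2_def by simp
  have step: "energy z (Suc k) + (c1 k + c2 k) \<le> energy z k + 0" if "onset \<le> k" for k
    using energy_decrease[OF _ weight_Suc_ge[OF that] z] onset_ge(2) that by (simp add: c1_def c2_def)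
  note quasi = quasi_decreasing[of onset "energy z" "\<lambda>k. c1 k + c2 k" "\<lambda>_. 0",
      OF energy_nonneg _ summable_zero step]
  show "convergent (energy z)" using quasi(1) c1 c2 by simp
  have sum: "summable (\<lambda>k. c1 k + c2 k)" using quasi(2) c1 c2 by simp
  have "summable c1"
    by (rule summable_comparison_test'[OF sum, of onset]) (use c1 c2 in auto)
  then show "summable (\<lambda>k. (1 + real (Suc k) * (\<alpha> - 3)) / (\<alpha> - 1)\<^sup>2 * gap k)" unfolding c1_def .
  have "summable c2"
    by (rule summable_comparison_test'[OF sum, of onset]) (use c1 c2 in auto)
  then show "summable (\<lambda>k. s / 2 * (weight (Suc k) * (weight (Suc k) - 1)) * (norm (grad_jump k))\<^sup>2)"
    unfolding c2_def .
qed

lemma gap_bigo: "gap \<in> O(\<lambda>k. 1 / (real k)\<^sup>2)"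
proof -
  obtain z where z: "z \<in> argmin_set f" using minimizers by blast
  obtain B where B: "\<And>k. \<bar>energy z k\<bar> \<le> B"
    using convergent_imp_Bseq[OF energy_consequences(1)[OF z]] by (auto simp: Bseq_def)
  have "gap k \<le> (B * (\<alpha> - 1)\<^sup>2) * (1 / (real k)\<^sup>2)" if "k \<ge> 1" for k
  proof -
    have "(weight k)\<^sup>2 * gap k \<le> energy z k" using step_pos by (simp add: energy_def)
    with B[of k] have "(weight k)\<^sup>2 * gap k \<le> B" by linarith
    then show ?thesis using that alpha by (simp add: weight_def field_simps)
  qed
  then show ?thesis
    using gap_nonneg by (intro bigoI[of _ "B * (\<alpha> - 1)\<^sup>2"])
      (auto simp: eventually_sequentially intro!: exI[of _ 1])
qed

lemma grad_jump_smallo: "(\<lambda>k. (norm (grad_jump k))\<^sup>2) \<in> o(\<lambda>k. 1 / (real k)\<^sup>2)"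
proof -
  obtain z where z: "z \<in> argmin_set f" using minimizers by blast
  define c where "c k = s / 2 * (weight (Suc k) * (weight (Suc k) - 1))" for k
  have lim: "(\<lambda>k. c k * (norm (grad_jump k))\<^sup>2) \<longlonglongrightarrow> 0"
    using summable_LIMSEQ_zero[OF energy_consequences(3)[OF z]] by (simp add: c_def)
  have "(\<lambda>k. (norm (grad_jump k))\<^sup>2) \<in> o(\<lambda>k. 1 / c k)"
  proof (rule smalloI_tendsto)
    have "\<forall>\<^sub>F k in sequentially. c k \<noteq> 0"
      using eventually_ge_at_top[of onset]
    proof eventually_elim
      case (elim k)
      have "real (Suc k) > \<alpha>" using elim onset_ge by linarith
      then have "weight (Suc k) > 1" using alpha by (simp add: weight_def field_simps)
      then show ?case using step_pos by (simp add: c_def)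
    qed
    then show "\<forall>\<^sub>F k in sequentially. 1 / c k \<noteq> 0" by eventually_elim simp
    show "(\<lambda>k. (norm (grad_jump k))\<^sup>2 / (1 / c k)) \<longlonglongrightarrow> 0" using lim by (simp add: mult.commute)
  qed
  also have "(\<lambda>k. 1 / c k) \<in> O(\<lambda>k. 1 / (real k)\<^sup>2)"
  proof (rule bigoI)
    show "\<forall>\<^sub>F k in sequentially.
        norm (1 / c k) \<le> (4 * (\<alpha> - 1)\<^sup>2 / s) * norm (1 / (real k)\<^sup>2)"
      using eventually_ge_at_top[of "2 * onset"]
    proof eventually_elim
      case (elim k)
      have rearrange: "s / 2 * (a / r * (a / 2 / r)) = s * a\<^sup>2 / (4 * r\<^sup>2)" for a r :: real
        by (simp add: power2_eq_square)
      have k: "real k \<ge> 2 * \<alpha>" using elim onset_ge(1) by linarith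
      have "real k / (\<alpha> - 1) \<le> weight (Suc k)" using alpha by (simp add: weight_def divide_right_mono)
      moreover have "real k / 2 / (\<alpha> - 1) \<le> weight (Suc k) - 1"
      proof -
        have "weight (Suc k) - 1 = (real k + 2 - \<alpha>) / (\<alpha> - 1)"
          using alpha by (simp add: weight_def field_simps)
        then show ?thesis using alpha k by (simp add: divide_right_mono del: divide_divide_eq_left)
      qed
      ultimately have "real k / (\<alpha> - 1) * (real k / 2 / (\<alpha> - 1)) \<le> weight (Suc k) * (weight (Suc k) - 1)"
        using alpha by (intro mult_mono) (auto simp: weight_def)
      then have "s / 2 * (real k / (\<alpha> - 1) * (real k / 2 / (\<alpha> - 1))) \<le> c k"
        unfolding c_def using step_pos by (intro mult_left_mono) auto
      then have lower: "s * (real k)\<^sup>2 / (4 * (\<alpha> - 1)\<^sup>2) \<le> c k"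
        using rearrange[of "real k" "\<alpha> - 1"] by (simp only:)
      have pos: "0 < s * (real k)\<^sup>2 / (4 * (\<alpha> - 1)\<^sup>2)" using step_pos alpha k by simp
      then have "1 / c k \<le> 1 / (s * (real k)\<^sup>2 / (4 * (\<alpha> - 1)\<^sup>2))"
        using lower by (intro frac_le) auto
      then show ?case using pos lower by simp
    qed
  qed
  finally show ?thesis .
qed

section \<open>Function values at the Ravine points\<close>

text \<open>
  A gradient step from \<open>w k\<close> cannot go below the minimal value.
\<close>

lemma gradient_norm_le: "s / 2 * (norm (g (w k)))\<^sup>2 \<le> gap k"
proof -
  have "min_value f + s / 2 * (norm (g (w k)))\<^sup>2 \<le> f (w k)"
    using gradient_step[of "w k" "w k"] min_value_le[OF minimizers, of "w k - s *\<^sub>R g (w k)"] by simp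
  then show ?thesis by (simp add: gap_def)
qed

text \<open>
  The gradient at \<open>y (Suc k)\<close> is split as the one at \<open>w k\<close>, controlled by the gap, minus the jump between the
  two points.
\<close>

lemma gradient_y_norm_le: "s * (norm (g (y (Suc k))))\<^sup>2 \<le> 4 * gap k + 2 * s * (norm (grad_jump k))\<^sup>2"
proof -
  have "norm (g (y (Suc k))) \<le> norm (g (w k)) + norm (grad_jump k)"
    unfolding grad_jump_def by (metis norm_minus_commute norm_triangle_sub)
  then have "(norm (g (y (Suc k))))\<^sup>2 \<le> (norm (g (w k)) + norm (grad_jump k))\<^sup>2"
    by (intro power_mono) auto
  also have "\<dots> \<le> 2 * (norm (g (w k)))\<^sup>2 + 2 * (norm (grad_jump k))\<^sup>2" by (use sum_squares_bound[of "norm (g (w k))" "norm (grad_jump k)"] in \<open>simp add: power2_sum\<close>)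
  finally have "s * (norm (g (y (Suc k))))\<^sup>2 \<le> s * (2 * (norm (g (w k)))\<^sup>2 + 2 * (norm (grad_jump k))\<^sup>2)"
    using step_pos by simp
  with gradient_norm_le[of k] show ?thesis by (simp add: algebra_simps)
qed

text \<open>
  The tangent of \<open>f\<close> at \<open>y (Suc k)\<close> lies below \<open>f\<close> at \<open>w (Suc k)\<close>, which bounds \<open>f\<close> at \<open>y (Suc k)\<close> from above.
\<close>

lemma value_y_le: "f (y (Suc k)) - min_value f \<le> gap (Suc k) + 4 * gap k + 2 * s * (norm (grad_jump k))\<^sup>2"
proof -
  have "f (y (Suc k)) \<le> f (w (Suc k)) + s * (norm (g (y (Suc k))))\<^sup>2"
    using above_tangent[of "y (Suc k)" "w (Suc k)"] by (simp add: w_eq power2_norm_eq_inner)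
  with gradient_y_norm_le[of k] show ?thesis by (simp add: gap_def)
qed

lemma value_bound_eventually:
  "\<forall>\<^sub>F k in sequentially. norm (f (y k) - min_value f)
     \<le> norm (gap k + 4 * gap (k - 1) + 2 * s * (norm (grad_jump (k - 1)))\<^sup>2)"
  using eventually_ge_at_top[of 1]
proof eventually_elim
  case (elim k)
  then have "f (y k) - min_value f \<le> gap k + 4 * gap (k - 1) + 2 * s * (norm (grad_jump (k - 1)))\<^sup>2"
    using value_y_le[of "k - 1"] by simp
  with min_value_le[OF minimizers, of "y k"] show ?case by simp
qed

lemma inverse_square_shift: "(\<lambda>k. 1 / (real (k - 1))\<^sup>2) \<in> O(\<lambda>k. 1 / (real k)\<^sup>2)"
proof (rule bigoI[of _ 4])
  show "\<forall>\<^sub>F k in sequentially. norm (1 / (real (k - 1))\<^sup>2) \<le> 4 * norm (1 / (real k)\<^sup>2)"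
    using eventually_ge_at_top[of 2]
  proof eventually_elim
    case (elim k)
    then have "(real k)\<^sup>2 \<le> (2 * real (k - 1))\<^sup>2" by (intro power_mono) auto
    then have "(real k)\<^sup>2 \<le> 4 * (real (k - 1))\<^sup>2" by (simp only: power_mult_distrib) simp
    then show ?case using elim by (simp add: divide_simps)
  qed
qed

lemma values_bigo: "(\<lambda>k. f (y k) - min_value f) \<in> O(\<lambda>k. 1 / (real k)\<^sup>2)"
proof -
  have gap': "(\<lambda>k. gap (k - 1)) \<in> O(\<lambda>k. 1 / (real k)\<^sup>2)"
    by (rule landau_o.big_trans[OF landau_o.big.compose[OF gap_bigo filterlim_minus_const_nat_at_top] inverse_square_shift])
  have jump': "(\<lambda>k. (norm (grad_jump (k - 1)))\<^sup>2) \<in> O(\<lambda>k. 1 / (real k)\<^sup>2)"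
    by (rule landau_o.big_trans[OF landau_o.big.compose[OF landau_o.small_imp_big[OF grad_jump_smallo] filterlim_minus_const_nat_at_top]
          inverse_square_shift])
  have "(\<lambda>k. gap k + 4 * gap (k - 1) + 2 * s * (norm (grad_jump (k - 1)))\<^sup>2) \<in> O(\<lambda>k. 1 / (real k)\<^sup>2)"
    using gap_bigo gap' jump' step_pos by (intro sum_in_bigo) simp_all
  from landau_o.big_trans[OF landau_o.big_mono[OF value_bound_eventually] this] show ?thesis .
qed

lemma values_smallo:
  assumes "gap \<in> o(\<lambda>k. 1 / (real k)\<^sup>2)"
  shows "(\<lambda>k. f (y k) - min_value f) \<in> o(\<lambda>k. 1 / (real k)\<^sup>2)"
proof -
  have gap': "(\<lambda>k. gap (k - 1)) \<in> o(\<lambda>k. 1 / (real k)\<^sup>2)"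
    by (rule landau_o.small_big_trans[OF landau_o.small.compose[OF assms filterlim_minus_const_nat_at_top]
          inverse_square_shift])
  have jump': "(\<lambda>k. (norm (grad_jump (k - 1)))\<^sup>2) \<in> o(\<lambda>k. 1 / (real k)\<^sup>2)"
    by (rule landau_o.small_big_trans[OF landau_o.small.compose[OF grad_jump_smallo filterlim_minus_const_nat_at_top]
          inverse_square_shift])
  have "(\<lambda>k. gap k + 4 * gap (k - 1) + 2 * s * (norm (grad_jump (k - 1)))\<^sup>2) \<in> o(\<lambda>k. 1 / (real k)\<^sup>2)"
    using assms gap' jump' step_pos by (intro sum_in_smallo) simp_all
  from landau_o.big_small_trans[OF landau_o.big_mono[OF value_bound_eventually] this] show ?thesis .
qed

section \<open>Mechanical energy in the case \<open>\<alpha> > 3\<close>\<close>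

lemma weighted_gap_summable:
  assumes "\<alpha> > 3"
  shows "summable (\<lambda>k. (2 * real k + 1) * gap k)"
proof -
  obtain z where z: "z \<in> argmin_set f" using minimizers by blast
  define c where "c = 2 * (\<alpha> - 1)\<^sup>2 / (\<alpha> - 3)"
  show ?thesis
  proof (rule summable_comparison_test'[where N = 0])
    show "summable (\<lambda>k. c * ((1 + real (Suc k) * (\<alpha> - 3)) / (\<alpha> - 1)\<^sup>2 * gap k))"
      by (intro summable_mult energy_consequences(2)[OF z])
    fix k :: nat
    \<comment> \<open>\<open>c\<close> is chosen so that the right-hand side is \<open>2 (k + 1) + 2 / (\<alpha> - 3)\<close>.\<close>
    have "2 * real k + 1 \<le> c * ((1 + real (Suc k) * (\<alpha> - 3)) / (\<alpha> - 1)\<^sup>2)"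
      using assms alpha by (simp add: c_def field_simps)
    then have "(2 * real k + 1) * gap k \<le> c * ((1 + real (Suc k) * (\<alpha> - 3)) / (\<alpha> - 1)\<^sup>2) * gap k"
      by (intro mult_right_mono gap_nonneg)
    then show "norm ((2 * real k + 1) * gap k)
        \<le> c * ((1 + real (Suc k) * (\<alpha> - 3)) / (\<alpha> - 1)\<^sup>2 * gap k)"
      using gap_nonneg[of k] by (simp add: mult.assoc)
  qed
qed

text \<open>
  The increment \<open>Y - w k\<close> before the gradient step is the damped previous increment. Expanding the square of the
  increment after the step produces the inner product that \<open>gradient_step\<close> compares with the loss in \<open>f\<close>, so the gap
  plus the kinetic energy is at most what it would be with \<open>w k\<close> and \<open>Y\<close> as the last two points and with the
  gap taken at \<open>w k\<close>.
\<close>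

lemma mechanical_step:
  assumes "k \<ge> 1"
  shows "gap (Suc k) + kinetic (Suc k) \<le> gap k + (1 - \<alpha> / real (Suc k))\<^sup>2 * kinetic k"
proof -
  define Y G where "Y = y (Suc k)" and "G = g (y (Suc k))"
  have w: "w (Suc k) = Y - s *\<^sub>R G" using w_eq by (simp add: Y_def G_def)
  have "0 \<le> s / 2 * (norm (g (w k) - G))\<^sup>2" using step_pos by simp
  then have descent: "gap (Suc k) + s / 2 * (norm G)\<^sup>2 \<le> gap k + inner G (Y - w k)"
    using gradient_step[of Y "w k"] by (simp add: gap_def w G_def Y_def)
  have "w (Suc k) - w k = (Y - w k) - s *\<^sub>R G" unfolding w by simp
  then have "(norm (w (Suc k) - w k))\<^sup>2
      = (norm (Y - w k))\<^sup>2 - 2 * s * inner G (Y - w k) + s\<^sup>2 * (norm G)\<^sup>2"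
    by (simp only: norm_diff_scaleR_square)
  then have "kinetic (Suc k) = (norm (Y - w k))\<^sup>2 / (2 * s) - inner G (Y - w k) + s / 2 * (norm G)\<^sup>2"
    using step_pos by (simp add: kinetic_def field_simps power2_eq_square)
  moreover have "(norm (Y - w k))\<^sup>2 / (2 * s) = (1 - \<alpha> / real (Suc k))\<^sup>2 * kinetic k"
    by (simp add: Y_def y_Suc[OF assms] kinetic_def power_mult_distrib)
  ultimately show ?thesis using descent by linarith
qed

text \<open>
  Multiplying \<open>mechanical_step\<close> by \<open>(k + 1)\<^sup>2\<close> costs \<open>(2 k + 1) gap k\<close>, which is summable, and the damping
  returns at least \<open>(\<alpha> - 1) k\<close> times the kinetic energy. So \<open>F\<close> converges and both parts of \<open>F k / k\<close> are summable.
\<close>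

lemma mechanical_energy_tendsto_zero:
  assumes "\<alpha> > 3"
  shows "(\<lambda>k. (real k)\<^sup>2 * (gap k + kinetic k)) \<longlonglongrightarrow> 0"
proof -
  define F where "F k = (real k)\<^sup>2 * (gap k + kinetic k)" for k
  have F_nonneg: "0 \<le> F k" for k using gap_nonneg kinetic_nonneg by (simp add: F_def)
  have step: "F (Suc k) + (\<alpha> - 1) * (real k * kinetic k) \<le> F k + (2 * real k + 1) * gap k"
    if k: "onset \<le> k" for k
  proof -
    have k': "real k \<ge> \<alpha>" "k \<ge> 1" using onset_ge k by linarith+
    have "F (Suc k) \<le> (real (Suc k))\<^sup>2 * (gap k + (1 - \<alpha> / real (Suc k))\<^sup>2 * kinetic k)"
      unfolding F_def by (intro mult_left_mono mechanical_step k') simp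
    also have "\<dots> = (real (Suc k))\<^sup>2 * gap k + (real (Suc k) * (1 - \<alpha> / real (Suc k)))\<^sup>2 * kinetic k"
      by (simp only: distrib_left power_mult_distrib mult.assoc)
    also have "real (Suc k) * (1 - \<alpha> / real (Suc k)) = real k - (\<alpha> - 1)" by (simp add: field_simps)
    finally have "F (Suc k) \<le> (real (Suc k))\<^sup>2 * gap k + (real k - (\<alpha> - 1))\<^sup>2 * kinetic k" .
    \<comment> \<open>Giving up one factor keeps a loss linear in \<open>k\<close>.\<close>
    moreover have "(real k - (\<alpha> - 1))\<^sup>2 \<le> real k * (real k - (\<alpha> - 1))"
      unfolding power2_eq_square using k' alpha by (intro mult_right_mono) auto
    then have "(real k - (\<alpha> - 1))\<^sup>2 * kinetic k \<le> real k * (real k - (\<alpha> - 1)) * kinetic k"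
      using kinetic_nonneg by (rule mult_right_mono)
    ultimately show ?thesis by (simp add: F_def algebra_simps power2_eq_square)
  qed
  have dissipation: "0 \<le> (\<alpha> - 1) * (real k * kinetic k)" for k
    using alpha kinetic_nonneg by simp
  have quasi: "convergent F" "summable (\<lambda>k. (\<alpha> - 1) * (real k * kinetic k))"
    using quasi_decreasing[of onset F "\<lambda>k. (\<alpha> - 1) * (real k * kinetic k)"
        "\<lambda>k. (2 * real k + 1) * gap k", OF F_nonneg dissipation weighted_gap_summable[OF assms] step]
    by blast+
  have "summable (\<lambda>k. real k * kinetic k)"
    using quasi(2) alpha by (subst (asm) summable_cmult_iff) auto
  moreover have "summable (\<lambda>k. real k * gap k)"
    by (rule summable_comparison_test'[OF weighted_gap_summable[OF assms], of 0])
       (use gap_nonneg in \<open>auto simp: algebra_simps\<close>)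
  ultimately have "summable (\<lambda>k. real k * gap k + real k * kinetic k)" by (intro summable_add)
  then have "summable (\<lambda>k. F k / real k)"
    by (rule summable_cong[THEN iffD1, rotated])
       (auto simp: F_def power2_eq_square algebra_simps add_divide_distrib)
  from tendsto_zero_if_summable_over_index[OF quasi(1) F_nonneg this] show ?thesis
    by (simp add: F_def)
qed

lemma
  assumes "\<alpha> > 3"
  shows weighted_gap_tendsto_zero: "(\<lambda>k. (real k)\<^sup>2 * gap k) \<longlonglongrightarrow> 0"
    and weighted_increment_tendsto_zero: "(\<lambda>k. real k * norm (w k - w (k - 1))) \<longlonglongrightarrow> 0"
proof -
  note lim = mechanical_energy_tendsto_zero[OF assms]
  show "(\<lambda>k. (real k)\<^sup>2 * gap k) \<longlonglongrightarrow> 0"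
    by (rule tendsto_sandwich[OF _ _ tendsto_const lim])
       (use gap_nonneg kinetic_nonneg in \<open>auto simp: mult_left_mono\<close>)
  have "(\<lambda>k. (real k)\<^sup>2 * kinetic k) \<longlonglongrightarrow> 0"
    by (rule tendsto_sandwich[OF _ _ tendsto_const lim])
       (use gap_nonneg kinetic_nonneg in \<open>auto simp: mult_left_mono\<close>)
  then have "(\<lambda>k. sqrt (2 * s * ((real k)\<^sup>2 * kinetic k))) \<longlonglongrightarrow> sqrt (2 * s * 0)"
    by (intro tendsto_intros)
  moreover have "2 * s * ((real k)\<^sup>2 * kinetic k) = (real k * norm (w k - w (k - 1)))\<^sup>2" for k
    using step_pos by (simp add: kinetic_def power_mult_distrib)
  ultimately show "(\<lambda>k. real k * norm (w k - w (k - 1))) \<longlonglongrightarrow> 0" by simp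
qed

lemma gap_smallo:
  assumes "\<alpha> > 3"
  shows "gap \<in> o(\<lambda>k. 1 / (real k)\<^sup>2)"
proof (rule smalloI_tendsto)
  show "(\<lambda>k. gap k / (1 / (real k)\<^sup>2)) \<longlonglongrightarrow> 0"
    using weighted_gap_tendsto_zero[OF assms] by (simp add: mult.commute)
  show "\<forall>\<^sub>F k in sequentially. 1 / (real k)\<^sup>2 \<noteq> 0"
    using eventually_gt_at_top[of 0] by eventually_elim simp
qed

section \<open>Weak convergence\<close>

text \<open>
  The energy converges and its first summand tends to \<open>0\<close>, so the distance from \<open>lead k\<close> to \<open>z\<close> converges;
  and \<open>lead k - w k\<close> tends to \<open>0\<close> because the increments are \<open>o(1 / k)\<close>.
\<close>

lemma distance_convergent:
  assumes "\<alpha> > 3" and z: "z \<in> argmin_set f"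
  shows "convergent (\<lambda>k. norm (w k - z))"
proof -
  obtain e where e: "energy z \<longlonglongrightarrow> e"
    using energy_consequences(1)[OF z] by (auto simp: convergent_def)
  have "(\<lambda>k. sqrt (2 * s * (energy z k - (real k)\<^sup>2 * gap k / (\<alpha> - 1)\<^sup>2)))
      \<longlonglongrightarrow> sqrt (2 * s * (e - 0 / (\<alpha> - 1)\<^sup>2))"
    by (intro tendsto_intros e weighted_gap_tendsto_zero assms) (use alpha in auto)
  moreover have "2 * s * (energy z k - (real k)\<^sup>2 * gap k / (\<alpha> - 1)\<^sup>2) = (norm (lead k - z))\<^sup>2" for k
    using step_pos by (simp add: energy_def weight_def power_divide)
  ultimately have dist_lim: "(\<lambda>k. norm (lead k - z)) \<longlonglongrightarrow> sqrt (2 * s * e)" by simp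
  have "(\<lambda>k. norm (lead k - z) - norm (w k - z)) \<longlonglongrightarrow> 0"
  proof (rule Lim_null_comparison[OF _ weighted_increment_tendsto_zero[OF assms(1)]])
    have "norm (norm (lead k - z) - norm (w k - z)) \<le> real k * norm (w k - w (k - 1))"
      if "k \<ge> 1" for k
    proof -
      have "\<bar>norm (lead k - z) - norm (w k - z)\<bar> \<le> norm ((lead k - z) - (w k - z))"
        by (rule norm_triangle_ineq3)
      also have "\<dots> = \<bar>weight k - 1\<bar> * norm (w k - w (k - 1))" by (simp add: lead_def)
      also have "\<bar>weight k - 1\<bar> \<le> real k"
      proof -
        have "0 \<le> weight k" "weight k \<le> real k"
          using alpha mult_left_mono[of 1 "\<alpha> - 1" "real k"] by (auto simp: weight_def divide_le_eq)
        then show ?thesis using that by (simp add: abs_le_iff)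
      qed
      finally show ?thesis by (simp add: mult_right_mono)
    qed
    then show "\<forall>\<^sub>F k in sequentially. norm (norm (lead k - z) - norm (w k - z))
        \<le> real k * norm (w k - w (k - 1))"
      by (auto simp: eventually_sequentially intro!: exI[of _ 1])
  qed
  from tendsto_diff[OF dist_lim this] show ?thesis by (auto simp: convergent_def)
qed

lemma inverse_square_smallo: "(\<lambda>k. 1 / (real k)\<^sup>2) \<in> o(\<lambda>_. 1)"
  using tendsto_power[OF lim_1_over_n, of 2] by (intro smalloI_tendsto) (auto simp: power_divide)

lemma gap_tendsto_zero: "gap \<longlonglongrightarrow> 0"
  using smalloD_tendsto[OF landau_o.big_small_trans[OF gap_bigo inverse_square_smallo]] by simp

lemma grad_jump_tendsto_zero: "(\<lambda>k. (norm (grad_jump k))\<^sup>2) \<longlonglongrightarrow> 0"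
  using smalloD_tendsto[OF landau_o.small_trans[OF grad_jump_smallo inverse_square_smallo]] by simp

lemma values_tendsto_min: "(\<lambda>k. f (w k)) \<longlonglongrightarrow> min_value f"
  using tendsto_add[OF gap_tendsto_zero tendsto_const[of "min_value f"]] by (simp add: gap_def)

text \<open>
  The values along \<open>w\<close> tend to the minimum, so every sublevel set of \<open>f\<close> above it, being closed and convex and
  containing a tail of \<open>w\<close>, contains the core.
\<close>

lemma tail_core_minimizes: "tail_core w UNIV \<subseteq> argmin_set f"
proof
  fix p assume p: "p \<in> tail_core w UNIV"
  have "f p \<le> min_value f"
  proof (rule field_le_epsilon)
    fix e :: real assume "e > 0"
    then have "\<forall>\<^sub>F k in sequentially. f (w k) < min_value f + e"
      using values_tendsto_min by (intro order_tendstoD) auto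
    then obtain N where N: "\<And>k. N \<le> k \<Longrightarrow> f (w k) < min_value f + e"
      by (auto simp: eventually_sequentially)
    have "tail_core w UNIV \<subseteq> {x. f x \<le> min_value f + e}"
    proof (rule tail_core_subset_closed_convex)
      show "closed {x. f x \<le> min_value f + e}"
        by (intro closed_Collect_le continuous continuous_intros)
      show "convex {x. f x \<le> min_value f + e}"
      proof (rule convexI)
        fix a b and r t :: real
        assume ab: "a \<in> {x. f x \<le> min_value f + e}" "b \<in> {x. f x \<le> min_value f + e}"
          and rt: "0 \<le> r" "0 \<le> t" "r + t = 1"
        have "f (r *\<^sub>R a + t *\<^sub>R b) \<le> max (f a) (f b)"
          by (rule convex_lower[OF convex _ _ rt]) auto
        with ab show "r *\<^sub>R a + t *\<^sub>R b \<in> {x. f x \<le> min_value f + e}" by simp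
      qed
    qed (use N in \<open>auto intro: less_imp_le\<close>)
    with p show "f p \<le> min_value f + e" by auto
  qed
  then show "p \<in> argmin_set f" using argmin_set_iff[OF minimizers] by simp
qed

lemma y_minus_w_tendsto_zero: "(\<lambda>k. y k - w k) \<longlonglongrightarrow> 0"
proof -
  have bound: "(\<lambda>k. 4 * gap k + 2 * s * (norm (grad_jump k))\<^sup>2) \<longlonglongrightarrow> 0"
    using tendsto_add[OF tendsto_mult_right_zero[OF gap_tendsto_zero, of 4]
        tendsto_mult_right_zero[OF grad_jump_tendsto_zero, of "2 * s"]] by simp
  have "(\<lambda>k. s * (norm (g (y (Suc k))))\<^sup>2) \<longlonglongrightarrow> 0"
    by (rule Lim_null_comparison[OF _ bound])
       (use gradient_y_norm_le step_pos in \<open>simp add: always_eventually\<close>)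
  then have "(\<lambda>k. sqrt (s * (s * (norm (g (y (Suc k))))\<^sup>2))) \<longlonglongrightarrow> sqrt (s * 0)"
    by (intro tendsto_intros)
  then have "(\<lambda>k. norm (y (Suc k) - w (Suc k))) \<longlonglongrightarrow> 0"
    using step_pos by (simp add: w_eq real_sqrt_mult mult.assoc[symmetric])
  then show ?thesis by (subst (asm) filterlim_sequentially_Suc) (simp add: tendsto_norm_zero_iff)
qed

end

theorem theorem2p3:
  fixes f :: "'a::{real_inner, complete_space} \<Rightarrow> real"
    and g :: "'a \<Rightarrow> 'a"
    and L s \<alpha> :: real
    and y w :: "nat \<Rightarrow> 'a"
  assumes gradient: "\<And>x. GDERIV f x :> g x"
    and C1: "continuous_on UNIV g"
    and lipschitz: "L-lipschitz_on UNIV g"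
    and convex: "convex_on UNIV f"
    and minimizers: "argmin_set f \<noteq> {}"
    and step: "s > 0" "s * L \<le> 1"
    and alpha: "\<alpha> \<ge> 3"
    and algorithm: "RAG g \<alpha> s y w"
  shows "(\<lambda>k. f (y k) - min_value f) \<in> O(\<lambda>k. 1 / (real k)\<^sup>2) \<and>
    (\<alpha> > 3 \<longrightarrow>
      (\<lambda>k. f (y k) - min_value f) \<in> o(\<lambda>k. 1 / (real k)\<^sup>2) \<and>
      (\<forall>x :: nat \<Rightarrow> 'a. (\<forall>k. x (k + 1) = y k - s *\<^sub>R g (y k)) \<longrightarrow>
        (\<exists>l \<in> argmin_set f. weakly_converges y l \<and> weakly_converges x l)))"
proof -
  have "L \<le> 1 / s" using step by (simp add: field_simps)
  then have "(1 / s)-lipschitz_on UNIV g" by (rule lipschitz_on_le[OF lipschitz])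
  then interpret ravine f g s \<alpha> y w
    using gradient convex step(1) minimizers alpha algorithm by unfold_locales
  have weak: "\<exists>l \<in> argmin_set f. weakly_converges y l \<and> weakly_converges x l"
    if a: "\<alpha> > 3" and x: "\<forall>k. x (k + 1) = y k - s *\<^sub>R g (y k)" for x
  proof -
    obtain l where l: "l \<in> argmin_set f" "weakly_converges w l"
      using opial[OF minimizers distance_convergent[OF a] tail_core_minimizes] by blast
    have "weakly_converges y l"
      using l(2) y_minus_w_tendsto_zero by (rule weakly_converges_add_null)
    \<comment> \<open>The sequence \<open>x\<close> is \<open>w\<close> delayed by one index; its first term is arbitrary.\<close>
    moreover have "(\<lambda>k. x (Suc k)) = w" using x w_eq by auto
    then have "weakly_converges x l" using l(2) weakly_converges_offset[of x l] by simp
    ultimately show ?thesis using l(1) by blast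
  qed
  show ?thesis using values_bigo values_smallo[OF gap_smallo] weak by blast
qed

end
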